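(* Let $H$ be a finite hypergraph with positive functions $\delta_{V(H)}:V(H)\to(0,\infty)$ and $\delta_{E(H)}:E(H)\to(0,\infty)$, and let $W_{E_i}$ and $W_{E_j}$ be a pair of equipotent twin units in $H$ with $|W_{E_i}|=|W_{E_j}|=m$. Suppose $\delta_{V(H)}(v)=c$, a constant, for all $v\in W_{E_i}\cup W_{E_j}$, and $\frac{\delta_{E(H)}(e)}{|e|^2}=w$, a constant, for all $e\in E_i\cup E_j$. Let $s=|E_i|$. Then $\frac{w}{c}s(m-1)$ is an eigenvalue of $A_{(H,\delta_{V(H)},\delta_{E(H)})}$ and $\frac{w}{c}ms$ is an eigenvalue of $Q_{(H,\delta_{V(H)},\delta_{E(H)})}$, in both cases with the eigenvector $y=|W_{E_i}|\chi_{W_{E_j}}-|W_{E_j}|\chi_{W_{E_i}}$.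
   Context: A (finite) hypergraph $H$ is a pair $(V(H),E(H))$, where $V(H)$ is a non-empty finite set and $E(H)$ is a collection of non-empty subsets of $V(H)$. For $v\in V(H)$ the star is $E_v(H)=\{e\in E(H):v\in e\}$. $\chi_U$ denotes the characteristic function of $U\subseteq V(H)$. Units: the relation $E_u(H)=E_v(H)$ is an equivalence relation on $V(H)$; its classes are called units. A unit is written $W_E$, where $E\subseteq E(H)$ is its generating set: $W_E=\{v\in V(H):E_v(H)=E\}$. Two distinct units $W_E,W_F$ are twin units if there is a bijection $\mathfrak{f}_{EF}:E\to F$ (the canonical bijection) such that $\mathfrak{f}_{EF}(e)=(e\setminus W_E)\cup W_F$ for all $e\in E$. The general adjacency and general signless Laplacian operators on $\mathbb{C}^{V(H)}$ are $$(A_{(H,\delta_{V(H)},\delta_{E(H)})}x)(v)=\sum_{e\in E_v(H)}\frac{\delta_{E(H)}(e)}{\delta_{V(H)}(v)}\frac{1}{|e|^2}\sum_{u\in e;\,u\neq v}x(u),$$ $$(Q_{(H,\delta_{V(H)},\delta_{E(H)})}x)(v)=\sum_{e\in E_v(H)}\frac{\delta_{E(H)}(e)}{\delta_{V(H)}(v)}\frac{1}{|e|^2}\sum_{u\in e}x(u).$$ *)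

theory Defs
  imports Complex_Main "HOL-Library.Indicator_Function"
begin

record 'a pre_hypergraph =
  verts :: "'a set"
  edges :: "'a set set"

definition hypergraph :: "'a pre_hypergraph \<Rightarrow> bool" where
  "hypergraph H \<longleftrightarrow>
     finite (verts H) \<and> verts H \<noteq> {} \<and> (\<forall>e\<in>edges H. e \<noteq> {} \<and> e \<subseteq> verts H)"

definition star :: "'a pre_hypergraph \<Rightarrow> 'a \<Rightarrow> 'a set set" where
  "star H v = {e \<in> edges H. v \<in> e}"

definition star_rel :: "'a pre_hypergraph \<Rightarrow> ('a \<times> 'a) set" where
  "star_rel H = {(u, v). u \<in> verts H \<and> v \<in> verts H \<and> star H u = star H v}"

definition hyper_units :: "'a pre_hypergraph \<Rightarrow> 'a set set" where
  "hyper_units H = verts H // star_rel H"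

text \<open>The set \<open>W\<^sub>E\<close>. It is empty, hence not a unit, unless \<open>E\<close> is the star of some vertex.\<close>

definition unit_of :: "'a pre_hypergraph \<Rightarrow> 'a set set \<Rightarrow> 'a set" where
  "unit_of H E = {v \<in> verts H. star H v = E}"

lemma equiv_star_rel: "equiv (verts H) (star_rel H)"
  by (auto simp: equiv_def star_rel_def refl_on_def sym_def trans_def)

lemma unit_of_in_hyper_units_iff:
  "unit_of H E \<in> hyper_units H \<longleftrightarrow> (\<exists>v\<in>verts H. star H v = E)"
proof
  assume "unit_of H E \<in> hyper_units H"
  then have "unit_of H E \<noteq> {}"
    unfolding hyper_units_def using equiv_star_rel in_quotient_imp_non_empty by metis
  then show "\<exists>v\<in>verts H. star H v = E"
    by (auto simp: unit_of_def)
next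
  assume "\<exists>v\<in>verts H. star H v = E"
  then obtain v where v: "v \<in> verts H" "star H v = E" by blast
  then have "unit_of H E = star_rel H `` {v}"
    by (auto simp: unit_of_def star_rel_def)
  with v show "unit_of H E \<in> hyper_units H"
    by (auto simp: hyper_units_def intro: quotientI)
qed

text \<open>Twin units are described through their generating sets \<open>E\<close> and \<open>F\<close>.\<close>

definition twin_units :: "'a pre_hypergraph \<Rightarrow> 'a set set \<Rightarrow> 'a set set \<Rightarrow> bool" where
  "twin_units H E F \<longleftrightarrow>
     unit_of H E \<in> hyper_units H \<and> unit_of H F \<in> hyper_units H \<and>
     unit_of H E \<noteq> unit_of H F \<and>
     (\<exists>f. bij_betw f E F \<and> (\<forall>e\<in>E. f e = (e - unit_of H E) \<union> unit_of H F))"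

text \<open>The space \<open>\<complex>\<^bsup>V\<^esup>\<close> is represented by the functions that vanish outside \<open>V\<close>, so that
  equality of vectors is equality of functions; accordingly the operators below return
  \<open>0\<close> outside the vertex set.\<close>

definition cvec :: "'a set \<Rightarrow> ('a \<Rightarrow> complex) set" where
  "cvec V = {x. \<forall>v. v \<notin> V \<longrightarrow> x v = 0}"

definition gen_adjacency ::
  "'a pre_hypergraph \<Rightarrow> ('a \<Rightarrow> real) \<Rightarrow> ('a set \<Rightarrow> real) \<Rightarrow> ('a \<Rightarrow> complex) \<Rightarrow> 'a \<Rightarrow> complex" where
  "gen_adjacency H \<delta>V \<delta>E x v =
     (if v \<in> verts H
      then (\<Sum>e\<in>star H v.
              complex_of_real (\<delta>E e / \<delta>V v * (1 / (real (card e))\<^sup>2)) * (\<Sum>u\<in>e - {v}. x u))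
      else 0)"

definition gen_signless_laplacian ::
  "'a pre_hypergraph \<Rightarrow> ('a \<Rightarrow> real) \<Rightarrow> ('a set \<Rightarrow> real) \<Rightarrow> ('a \<Rightarrow> complex) \<Rightarrow> 'a \<Rightarrow> complex" where
  "gen_signless_laplacian H \<delta>V \<delta>E x v =
     (if v \<in> verts H
      then (\<Sum>e\<in>star H v.
              complex_of_real (\<delta>E e / \<delta>V v * (1 / (real (card e))\<^sup>2)) * (\<Sum>u\<in>e. x u))
      else 0)"

lemma gen_adjacency_in_cvec: "gen_adjacency H \<delta>V \<delta>E x \<in> cvec (verts H)"
  by (simp add: cvec_def gen_adjacency_def)

lemma gen_signless_laplacian_in_cvec: "gen_signless_laplacian H \<delta>V \<delta>E x \<in> cvec (verts H)"
  by (simp add: cvec_def gen_signless_laplacian_def)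

definition eigenvector_on ::
  "'a set \<Rightarrow> (('a \<Rightarrow> complex) \<Rightarrow> 'a \<Rightarrow> complex) \<Rightarrow> complex \<Rightarrow> ('a \<Rightarrow> complex) \<Rightarrow> bool" where
  "eigenvector_on V T k x \<longleftrightarrow> x \<in> cvec V \<and> x \<noteq> (\<lambda>v. 0) \<and> T x = (\<lambda>v. k * x v)"

definition eigenvalue_on ::
  "'a set \<Rightarrow> (('a \<Rightarrow> complex) \<Rightarrow> 'a \<Rightarrow> complex) \<Rightarrow> complex \<Rightarrow> bool" where
  "eigenvalue_on V T k \<longleftrightarrow> (\<exists>x. eigenvector_on V T k x)"

end

theory Submission
  imports Defs
begin

text \<open>
  A twin difference vector \<open>y\<close>, equal to \<open>m\<close> on one twin unit, to \<open>-m\<close> on the other and to \<open>0\<close>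
  elsewhere, is almost invisible to the edges: an edge contains a unit entirely or misses it, and
  no edge contains both twins, because every edge of \<open>F\<close> is \<open>(e - W\<^sub>E) \<union> W\<^sub>F\<close> for some \<open>e \<in> E\<close>.
  Hence \<open>y\<close> sums to \<open>m\<^sup>2\<close> over each edge of \<open>F\<close>, to \<open>-m\<^sup>2\<close> over each edge of \<open>E\<close> and to
  \<open>0\<close> over every other edge (\<open>sum_twin_difference\<close>).

  All edges \<open>e\<close> of \<open>E \<union> F\<close> share the weight \<open>\<delta>E(e) / |e|\<^sup>2 = w\<close>, so \<open>(Q y)(v)\<close> is \<open>m\<^sup>2 w / \<delta>V(v)\<close> times the
  excess of the edges of \<open>F\<close> through \<open>v\<close> over those of \<open>E\<close>
  (\<open>gen_signless_laplacian_twin_difference\<close>). At a vertex of \<open>W\<^sub>F\<close> or \<open>W\<^sub>E\<close> this excess is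
  \<open>s\<close> or \<open>-s\<close>, which gives \<open>(w/c) m s y(v)\<close>. At any other vertex it vanishes, since
  exchanging the twins preserves membership of \<open>v\<close> in an edge
  (\<open>twin_units_card_inter_star\<close>).

  Finally \<open>A\<close> is \<open>Q\<close> minus the diagonal operator of weighted degrees. On the support of \<open>y\<close> the
  weighted degree is the constant \<open>(w/c) s\<close>, so \<open>y\<close> stays an eigenvector and its eigenvalue drops
  by that amount.
\<close>

section \<open>Units and edges\<close>

lemma hypergraph_finite_edges: "hypergraph H \<Longrightarrow> finite (edges H)"
  by (rule finite_subset[of _ "Pow (verts H)"]) (auto simp: hypergraph_def)

lemma hypergraph_finite_edge: "hypergraph H \<Longrightarrow> e \<in> edges H \<Longrightarrow> finite e"
  by (auto simp: hypergraph_def intro: finite_subset)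

text \<open>The vertices of a unit lie on the same edges, so an edge contains all of them or none.\<close>

lemma edge_inter_unit_of:
  assumes "hypergraph H" "e \<in> edges H"
  shows "e \<inter> unit_of H E = (if e \<in> E then unit_of H E else {})"
  using assms by (auto simp: unit_of_def star_def hypergraph_def)

lemma unit_of_disjoint: "E \<noteq> F \<Longrightarrow> unit_of H E \<inter> unit_of H F = {}"
  by (auto simp: unit_of_def)

section \<open>Exchanging twin units\<close>

text \<open>The canonical bijection is determined on \<open>E\<close>, so it can be taken to be the exchange map
  itself, with no function left to choose.\<close>

lemma twin_unitsE:
  assumes "twin_units H E F"
  obtains "unit_of H E \<noteq> {}" "unit_of H F \<noteq> {}" "E \<noteq> F" "E \<subseteq> edges H" "F \<subseteq> edges H"
    "bij_betw (\<lambda>e. (e - unit_of H E) \<union> unit_of H F) E F"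
proof -
  from assms obtain u v f where
    u: "u \<in> verts H" "star H u = E" and v: "v \<in> verts H" "star H v = F"
    and f: "bij_betw f E F" "\<forall>e\<in>E. f e = (e - unit_of H E) \<union> unit_of H F"
    by (auto simp: twin_units_def unit_of_in_hyper_units_iff)
  have "bij_betw (\<lambda>e. (e - unit_of H E) \<union> unit_of H F) E F"
    using f bij_betw_cong[of E f "\<lambda>e. (e - unit_of H E) \<union> unit_of H F" F] by auto
  moreover have "u \<in> unit_of H E" "v \<in> unit_of H F"
    using u v by (auto simp: unit_of_def)
  moreover have "E \<noteq> F"
    using assms by (auto simp: twin_units_def)
  ultimately show thesis
    using u v by (intro that) (auto simp: star_def)
qed

text \<open>An edge of \<open>F\<close> is the image of an edge under the exchange and so has lost all of \<open>W\<^sub>E\<close>, whereas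
  an edge of \<open>E\<close> contains the non-empty set \<open>W\<^sub>E\<close>.\<close>

lemma twin_units_generators_disjoint:
  assumes "hypergraph H" "twin_units H E F"
  shows "E \<inter> F = {}"
proof (rule ccontr)
  assume "E \<inter> F \<noteq> {}"
  then obtain e where e: "e \<in> E" "e \<in> F" by blast
  from assms(2) show False
  proof (rule twin_unitsE)
    assume W: "unit_of H E \<noteq> {}" "E \<noteq> F" "E \<subseteq> edges H"
      and bij: "bij_betw (\<lambda>e. (e - unit_of H E) \<union> unit_of H F) E F"
    from e bij obtain d where "e = (d - unit_of H E) \<union> unit_of H F"
      by (auto simp: bij_betw_def)
    with unit_of_disjoint[OF W(2), of H] have "e \<inter> unit_of H E = {}" by blast
    moreover have "e \<inter> unit_of H E = unit_of H E"
      using edge_inter_unit_of[OF assms(1), of e E] e W(3) by auto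
    ultimately show False using W(1) by simp
  qed
qed

text \<open>The exchange changes edges only inside the two units; hence it restricts to a bijection
  between the edges of \<open>E\<close> and of \<open>F\<close> through a vertex outside them.\<close>

lemma twin_units_card_inter_star:
  assumes "twin_units H E F" "v \<notin> unit_of H E" "v \<notin> unit_of H F"
  shows "card (E \<inter> star H v) = card (F \<inter> star H v)"
  using assms(1)
proof (rule twin_unitsE)
  let ?f = "\<lambda>e. (e - unit_of H E) \<union> unit_of H F"
  assume edges: "E \<subseteq> edges H" "F \<subseteq> edges H" and bij: "bij_betw ?f E F"
  have img: "?f ` E = F" and inj: "inj_on ?f E"
    using bij by (auto simp: bij_betw_def)
  have through: "v \<in> ?f e \<longleftrightarrow> v \<in> e" for e
    using assms(2,3) by blast
  have E: "E \<inter> star H v = {e \<in> E. v \<in> e}" and F: "F \<inter> star H v = {e \<in> F. v \<in> e}"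
    using edges by (auto simp: star_def)
  have "?f ` {e \<in> E. v \<in> e} = {e \<in> ?f ` E. v \<in> e}"
    using through by blast
  then have "bij_betw ?f (E \<inter> star H v) (F \<inter> star H v)"
    unfolding E F img using inj by (auto simp: bij_betw_def intro: inj_on_subset)
  then show ?thesis by (rule bij_betw_same_card)
qed

lemma twin_units_card_generators: "twin_units H E F \<Longrightarrow> card E = card F"
  by (auto simp: twin_units_def intro: bij_betw_same_card)

section \<open>Adjacency and signless Laplacian\<close>

lemma gen_adjacency_eq_signless_laplacian_minus_degree:
  assumes "hypergraph H" "v \<in> verts H"
  shows "gen_adjacency H \<delta>V \<delta>E x v = gen_signless_laplacian H \<delta>V \<delta>E x v
     - (\<Sum>e\<in>star H v. complex_of_real (\<delta>E e / \<delta>V v * (1 / (real (card e))\<^sup>2))) * x v"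
proof -
  have "(\<Sum>u\<in>e - {v}. x u) = (\<Sum>u\<in>e. x u) - x v" if "e \<in> star H v" for e
    using that hypergraph_finite_edge[OF assms(1)] by (simp add: star_def sum_diff1)
  then show ?thesis
    using assms(2)
    by (simp add: gen_adjacency_def gen_signless_laplacian_def right_diff_distrib
        sum_subtractf sum_distrib_right)
qed

section \<open>The twin difference vector\<close>

lemma sum_indicator_eq_of_nat_card:
  "finite A \<Longrightarrow> (\<Sum>x\<in>A. indicator B x :: 'b::semiring_1) = of_nat (card (A \<inter> B))"
  by (simp add: indicator_def sum.If_cases)

definition twin_difference :: "'a pre_hypergraph \<Rightarrow> 'a set set \<Rightarrow> 'a set set \<Rightarrow> 'a \<Rightarrow> complex" where
  "twin_difference H E F v = of_nat (card (unit_of H E)) * indicator (unit_of H F) v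
     - of_nat (card (unit_of H F)) * indicator (unit_of H E) v"

text \<open>An edge picks up the whole unit \<open>W\<^sub>F\<close> when it belongs to \<open>F\<close> and the whole unit \<open>W\<^sub>E\<close> when it
  belongs to \<open>E\<close>. The cross-weighting by the cardinality of the opposite unit makes both
  contributions equal in size.\<close>

lemma sum_twin_difference:
  assumes "hypergraph H" "e \<in> edges H"
  shows "(\<Sum>u\<in>e. twin_difference H E F u)
    = of_nat (card (unit_of H E) * card (unit_of H F)) * (indicator F e - indicator E e)"
proof -
  have fin: "finite e" using hypergraph_finite_edge[OF assms] .
  have "(\<Sum>u\<in>e. indicator (unit_of H G) u :: complex)
      = of_nat (card (unit_of H G)) * indicator G e" for G
    by (simp add: sum_indicator_eq_of_nat_card[OF fin] edge_inter_unit_of[OF assms])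
  then show ?thesis
    by (simp add: twin_difference_def sum_subtractf sum_distrib_left[symmetric])
      (simp add: algebra_simps)
qed

text \<open>Only the edges of \<open>E\<close> and \<open>F\<close> contribute, all with the same weight; so counting them is enough.
  An edge common to \<open>E\<close> and \<open>F\<close> is counted twice with opposite signs, in accordance with the sum
  over it being zero.\<close>

lemma gen_signless_laplacian_twin_difference:
  assumes H: "hypergraph H" and v: "v \<in> verts H"
    and w: "\<And>e. e \<in> E \<union> F \<Longrightarrow> \<delta>E e / (real (card e))\<^sup>2 = w"
  shows "gen_signless_laplacian H \<delta>V \<delta>E (twin_difference H E F) v
    = complex_of_real (w / \<delta>V v) * of_nat (card (unit_of H E) * card (unit_of H F))
      * (of_nat (card (F \<inter> star H v)) - of_nat (card (E \<inter> star H v)))"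
proof -
  let ?M = "of_nat (card (unit_of H E) * card (unit_of H F)) :: complex"
  have fin: "finite (star H v)"
    using hypergraph_finite_edges[OF H] by (simp add: star_def)
  have "complex_of_real (\<delta>E e / \<delta>V v * (1 / (real (card e))\<^sup>2)) * (\<Sum>u\<in>e. twin_difference H E F u)
      = complex_of_real (w / \<delta>V v) * ?M * (indicator F e - indicator E e)" if "e \<in> star H v" for e
  proof (cases "e \<in> E \<union> F")
    case True
    then have "\<delta>E e / \<delta>V v * (1 / (real (card e))\<^sup>2) = w / \<delta>V v"
      using w[of e] by (auto simp: field_simps)
    then show ?thesis
      using sum_twin_difference[OF H, of e E F] that by (simp add: star_def mult.assoc)
  next
    case False
    then show ?thesis
      using sum_twin_difference[OF H, of e E F] that by (simp add: star_def)
  qed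
  then have "gen_signless_laplacian H \<delta>V \<delta>E (twin_difference H E F) v
      = (\<Sum>e\<in>star H v. complex_of_real (w / \<delta>V v) * ?M * (indicator F e - indicator E e))"
    using v by (simp add: gen_signless_laplacian_def)
  also have "\<dots> = complex_of_real (w / \<delta>V v) * ?M
      * (of_nat (card (star H v \<inter> F)) - of_nat (card (star H v \<inter> E)))"
    using fin by (simp only: sum_distrib_left[symmetric] sum_subtractf sum_indicator_eq_of_nat_card)
  finally show ?thesis by (simp only: Int_commute)
qed

lemma twin_difference_in_cvec: "twin_difference H E F \<in> cvec (verts H)"
  by (auto simp: cvec_def twin_difference_def unit_of_def)

lemma twin_difference_nonzero:
  assumes "hypergraph H" "twin_units H E F"
  shows "twin_difference H E F \<noteq> (\<lambda>v. 0)"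
  using assms(2)
proof (rule twin_unitsE)
  assume ne: "unit_of H E \<noteq> {}" "unit_of H F \<noteq> {}" and "E \<noteq> F"
  then obtain u where u: "u \<in> unit_of H F" "u \<notin> unit_of H E"
    using unit_of_disjoint by blast
  have "finite (unit_of H E)"
    using assms(1) by (simp add: hypergraph_def unit_of_def)
  then have "twin_difference H E F u \<noteq> 0"
    using u ne by (simp add: twin_difference_def)
  then show ?thesis by auto
qed

section \<open>The eigenvector equations\<close>

theorem theorem3p13:
  fixes H :: "'a pre_hypergraph"
    and \<delta>V :: "'a \<Rightarrow> real" and \<delta>E :: "'a set \<Rightarrow> real"
    and Ei Ej :: "'a set set"
    and c w :: real and m s :: nat
    and y :: "'a \<Rightarrow> complex"
  assumes "hypergraph H"
    and "\<And>v. v \<in> verts H \<Longrightarrow> \<delta>V v > 0"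
    and "\<And>e. e \<in> edges H \<Longrightarrow> \<delta>E e > 0"
    and "twin_units H Ei Ej"
    and "card (unit_of H Ei) = m" and "card (unit_of H Ej) = m"
    and "\<And>v. v \<in> unit_of H Ei \<union> unit_of H Ej \<Longrightarrow> \<delta>V v = c"
    and "\<And>e. e \<in> Ei \<union> Ej \<Longrightarrow> \<delta>E e / (real (card e))\<^sup>2 = w"
    and "s = card Ei"
    and "y = (\<lambda>v. of_nat (card (unit_of H Ei)) * indicator (unit_of H Ej) v
                - of_nat (card (unit_of H Ej)) * indicator (unit_of H Ei) v)"
  shows "eigenvalue_on (verts H) (gen_adjacency H \<delta>V \<delta>E)
           (complex_of_real (w / c * real s * (real m - 1)))
       \<and> eigenvector_on (verts H) (gen_adjacency H \<delta>V \<delta>E)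
           (complex_of_real (w / c * real s * (real m - 1))) y
       \<and> eigenvalue_on (verts H) (gen_signless_laplacian H \<delta>V \<delta>E)
           (complex_of_real (w / c * real m * real s))
       \<and> eigenvector_on (verts H) (gen_signless_laplacian H \<delta>V \<delta>E)
           (complex_of_real (w / c * real m * real s)) y"
proof -
  let ?Q = "gen_signless_laplacian H \<delta>V \<delta>E" and ?A = "gen_adjacency H \<delta>V \<delta>E"
  note H = assms(1) and twin = assms(4)
  have y: "y = twin_difference H Ei Ej"
    using assms(10) by (simp add: twin_difference_def fun_eq_iff)
  have disjoint: "Ei \<inter> Ej = {}"
    using twin_units_generators_disjoint[OF H twin] .
  have cards: "card Ei = s" "card Ej = s"
    using twin_units_card_generators[OF twin] assms(9) by simp_all
  have units: "unit_of H Ei \<inter> unit_of H Ej = {}"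
    using unit_of_disjoint twin by (metis twin_units_def)

  have Q: "?Q y v = complex_of_real (w / c * real m * real s) * y v" for v
  proof (cases "v \<in> verts H")
    case False
    then show ?thesis
      using twin_difference_in_cvec[of H Ei Ej]
      by (simp add: gen_signless_laplacian_def y cvec_def)
  next
    case True
    have eq: "?Q y v = complex_of_real (w / \<delta>V v) * of_nat (m * m)
        * (of_nat (card (Ej \<inter> star H v)) - of_nat (card (Ei \<inter> star H v)))"
      using gen_signless_laplacian_twin_difference[OF H True, of Ei Ej \<delta>E w \<delta>V] assms(5,6,8) y
      by simp
    consider "v \<in> unit_of H Ei" | "v \<in> unit_of H Ej" | "v \<notin> unit_of H Ei" "v \<notin> unit_of H Ej"
      by blast
    then show ?thesis
    proof cases
      case 1
      then have "v \<notin> unit_of H Ej"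
        using units by blast
      with 1 have "y v = - of_nat m" "\<delta>V v = c"
        using assms(5,6,7) by (simp_all add: y twin_difference_def)
      moreover have "star H v = Ei"
        using 1 by (simp add: unit_of_def)
      ultimately show ?thesis
        using eq disjoint cards by (simp add: Int_commute)
    next
      case 2
      then have "v \<notin> unit_of H Ei"
        using units by blast
      with 2 have "y v = of_nat m" "\<delta>V v = c"
        using assms(5,6,7) by (simp_all add: y twin_difference_def)
      moreover have "star H v = Ej"
        using 2 by (simp add: unit_of_def)
      ultimately show ?thesis
        using eq disjoint cards by simp
    next
      case 3
      then show ?thesis
        using eq twin_units_card_inter_star[OF twin] by (simp add: y twin_difference_def)
    qed
  qed

  have A: "?A y v = complex_of_real (w / c * real s * (real m - 1)) * y v" for v
  proof (cases "v \<in> verts H")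
    case False
    then show ?thesis
      using twin_difference_in_cvec[of H Ei Ej] by (simp add: gen_adjacency_def y cvec_def)
  next
    case True
    let ?d = "\<Sum>e\<in>star H v. complex_of_real (\<delta>E e / \<delta>V v * (1 / (real (card e))\<^sup>2))"
    have "?d * y v = complex_of_real (w / c * real s) * y v"
    proof (cases "v \<in> unit_of H Ei \<union> unit_of H Ej")
      case False
      then show ?thesis by (simp add: y twin_difference_def)
    next
      case True
      then have star: "star H v \<subseteq> Ei \<union> Ej" "card (star H v) = s"
        using cards by (auto simp: unit_of_def)
      have "\<delta>E e / \<delta>V v * (1 / (real (card e))\<^sup>2) = w / c" if "e \<in> star H v" for e
      proof -
        have weight: "\<delta>E e / (real (card e))\<^sup>2 = w"
          using assms(8)[of e] star(1) that by blast
        then show ?thesis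
          using assms(7)[OF True] by (simp flip: weight add: mult.commute)
      qed
      then show ?thesis
        using star(2) by simp
    qed
    then show ?thesis
      using gen_adjacency_eq_signless_laplacian_minus_degree[OF H True, of \<delta>V \<delta>E y] Q[of v]
      by (simp add: algebra_simps diff_divide_distrib)
  qed

  have "y \<in> cvec (verts H)" "y \<noteq> (\<lambda>v. 0)"
    using twin_difference_in_cvec twin_difference_nonzero[OF H twin] y by auto
  with Q A show ?thesis
    unfolding eigenvalue_on_def eigenvector_on_def by blast
qed

end
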